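(* Let $\Omega=\{1,\ldots,n\}$ with $n\in\mathbb{N}$, let $\mathcal{F}$ be the power set of $\Omega$ and $\mathcal{U}=\mathcal{F}\setminus\{\emptyset\}$. Let $1+r>0$, let $\mathcal{G}=\{S_1^1,\ldots,S_1^m\}\subset\mathbb{R}^\Omega$ be a finite non-empty collection of random variables (payoffs at time $1$), let $\underline{\pi}:\mathcal{G}\to\mathbb{R}$ be a lower price assessment, and put $\tilde S_1^k=(1+r)^{-1}S_1^k$ for $k=1,\ldots,m$. For $\boldsymbol{\lambda}=(\lambda_1,\ldots,\lambda_m)^T\in\mathbb{R}^m$ and $B\in\mathcal{U}$ let $$G_{\boldsymbol{\lambda}}(B)=\sum_{k=1}^m\lambda_k\left(\min_{i\in B}\tilde S_1^k(i)-\underline{\pi}(S_1^k)\right).$$ The following conditions are equivalent: (i) there exists a belief function $\widehat{Bel}$ on $\mathcal{F}$ such that $\mathbb{C}_{\widehat{Bel}}(\tilde S_1^k)=\underline{\pi}(S_1^k)$ for $k=1,\ldots,m$, where $\mathbb{C}_{\widehat{Bel}}$ denotes Choquet expectation with respect to $\widehat{Bel}$; (ii) for every $\boldsymbol{\lambda}=(\lambda_1,\ldots,\lambda_m)^T\in\mathbb{R}^m$ it holds that $$\min_{B\in\mathcal{U}}G_{\boldsymbol{\lambda}}(B)\le0\le\max_{B\in\mathcal{U}}G_{\boldsymbol{\lambda}}(B).$$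
   Context: A (normalized) capacity on $\mathcal{F}$ is a function $\varphi:\mathcal{F}\to[0,1]$ with $\varphi(\emptyset)=0$, $\varphi(\Omega)=1$ and $\varphi(A)\le\varphi(B)$ whenever $A\subseteq B$. A belief function is a capacity $\varphi$ that is completely monotone: for every $k\ge2$ and $A_1,\ldots,A_k\in\mathcal{F}$, $$\varphi\left(\bigcup_{i=1}^kA_i\right)\ge\sum_{\emptyset\neq K\subseteq\{1,\ldots,k\}}(-1)^{|K|-1}\varphi\left(\bigcap_{i\in K}A_i\right).$$ The Choquet expectation of $X\in\mathbb{R}^\Omega$ with respect to a capacity $\varphi$ is $$\mathbb{C}_\varphi(X)=\sum_{i=1}^n\bigl(X(\sigma(i))-X(\sigma(i+1))\bigr)\varphi(\{\sigma(1),\ldots,\sigma(i)\}),$$ where $\sigma$ is a permutation of $\Omega$ with $X(\sigma(1))\ge\cdots\ge X(\sigma(n))$ and $X(\sigma(n+1)):=0$. *)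

theory Defs
  imports Complex_Main "HOL-Library.FuncSet" "HOL-Combinatorics.Permutations"
begin

definition capacity :: "'a set \<Rightarrow> ('a set \<Rightarrow> real) \<Rightarrow> bool" where
  "capacity \<Omega> \<phi> \<longleftrightarrow>
     \<phi> \<in> Pow \<Omega> \<rightarrow> {0..1} \<and> \<phi> {} = 0 \<and> \<phi> \<Omega> = 1 \<and>
     (\<forall>A B. A \<subseteq> B \<and> B \<subseteq> \<Omega> \<longrightarrow> \<phi> A \<le> \<phi> B)"

definition completely_monotone :: "'a set \<Rightarrow> ('a set \<Rightarrow> real) \<Rightarrow> bool" where
  "completely_monotone \<Omega> \<phi> \<longleftrightarrow>
     (\<forall>k\<ge>2. \<forall>A \<in> {1..k::nat} \<rightarrow> Pow \<Omega>.
        \<phi> (\<Union>i\<in>{1..k}. A i) \<ge>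
          (\<Sum>K \<in> Pow {1..k} - {{}}. (-1) ^ (card K - 1) * \<phi> (\<Inter>i\<in>K. A i)))"

definition belief_function :: "'a set \<Rightarrow> ('a set \<Rightarrow> real) \<Rightarrow> bool" where
  "belief_function \<Omega> \<phi> \<longleftrightarrow> capacity \<Omega> \<phi> \<and> completely_monotone \<Omega> \<phi>"

definition decreasing_arrangement :: "nat \<Rightarrow> (nat \<Rightarrow> real) \<Rightarrow> (nat \<Rightarrow> nat) \<Rightarrow> bool" where
  "decreasing_arrangement n X \<sigma> \<longleftrightarrow>
     \<sigma> permutes {1..n} \<and> (\<forall>i\<in>{1..n}. \<forall>j\<in>{1..n}. i \<le> j \<longrightarrow> X (\<sigma> i) \<ge> X (\<sigma> j))"

text \<open>The conditional encodes the convention \<open>X (\<sigma> (n + 1)) = 0\<close>.\<close>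

definition choquet_sum :: "nat \<Rightarrow> (nat set \<Rightarrow> real) \<Rightarrow> (nat \<Rightarrow> real) \<Rightarrow> (nat \<Rightarrow> nat) \<Rightarrow> real" where
  "choquet_sum n \<phi> X \<sigma> =
     (\<Sum>i=1..n. (X (\<sigma> i) - (if i = n then 0 else X (\<sigma> (i + 1)))) * \<phi> (\<sigma> ` {1..i}))"

text \<open>A decreasing arrangement always exists and the sum does not depend on which one is
  chosen; see \<open>decreasing_arrangement_exists\<close> and \<open>choquet_eq\<close>.\<close>

definition choquet :: "nat \<Rightarrow> (nat set \<Rightarrow> real) \<Rightarrow> (nat \<Rightarrow> real) \<Rightarrow> real" where
  "choquet n \<phi> X = choquet_sum n \<phi> X (SOME \<sigma>. decreasing_arrangement n X \<sigma>)"

lemma decreasing_arrangement_exists: "\<exists>\<sigma>. decreasing_arrangement n X \<sigma>"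
proof -
  define xs where "xs = sort_key (\<lambda>i. - X i) [1..<n+1]"
  have len: "length xs = n" and dist: "distinct xs" and set: "set xs = {1..n}"
    by (auto simp: xs_def)
  have srt: "sorted (map (\<lambda>i. - X i) xs)"
    unfolding xs_def by (rule sorted_sort_key)
  define \<sigma> where "\<sigma> = (\<lambda>i. if i \<in> {1..n} then xs ! (i - 1) else i)"
  have inj: "inj_on \<sigma> {1..n}"
    using dist len by (auto simp: inj_on_def \<sigma>_def nth_eq_iff_index_eq)
  have img: "\<sigma> ` {1..n} \<subseteq> {1..n}"
  proof
    fix y assume "y \<in> \<sigma> ` {1..n}"
    then obtain i where "i \<in> {1..n}" "y = xs ! (i - 1)" by (auto simp: \<sigma>_def)
    then have "y \<in> set xs" using len by (auto intro!: nth_mem)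
    then show "y \<in> {1..n}" using set by simp
  qed
  have "bij_betw \<sigma> {1..n} {1..n}"
    using inj img by (simp add: bij_betw_def endo_inj_surj)
  then have "\<sigma> permutes {1..n}"
    by (rule bij_imp_permutes) (auto simp: \<sigma>_def)
  moreover have "X (\<sigma> i) \<ge> X (\<sigma> j)" if "i \<in> {1..n}" "j \<in> {1..n}" "i \<le> j" for i j
    using sorted_nth_mono[OF srt, of "i - 1" "j - 1"] that len by (auto simp: \<sigma>_def)
  ultimately show ?thesis unfolding decreasing_arrangement_def by blast
qed

lemma decreasing_arrangement_values:
  assumes "decreasing_arrangement n X \<sigma>" "decreasing_arrangement n X \<tau>" "i \<in> {1..n}"
  shows "X (\<sigma> i) \<le> X (\<tau> i)"
proof (rule ccontr)
  assume neg: "\<not> X (\<sigma> i) \<le> X (\<tau> i)"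
  have p: "\<sigma> permutes {1..n}" and q: "\<tau> permutes {1..n}"
    using assms by (auto simp: decreasing_arrangement_def)
  have "\<sigma> ` {1..i} \<subseteq> \<tau> ` {1..<i}"
  proof
    fix y assume "y \<in> \<sigma> ` {1..i}"
    then obtain j where j: "j \<in> {1..i}" "y = \<sigma> j" by auto
    then have j': "j \<in> {1..n}" using assms(3) by auto
    then have "y \<in> {1..n}" using permutes_in_image[OF p, of j] j by metis
    moreover have "X y \<ge> X (\<sigma> i)"
      using assms j j' by (auto simp: decreasing_arrangement_def)
    moreover obtain l where l: "l \<in> {1..n}" "y = \<tau> l"
      using \<open>y \<in> {1..n}\<close> permutes_image[OF q] by blast
    moreover have "l < i"
    proof (rule ccontr)
      assume "\<not> l < i"
      then have "X (\<tau> l) \<le> X (\<tau> i)"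
        using assms l by (auto simp: decreasing_arrangement_def)
      then show False using neg calculation by auto
    qed
    ultimately show "y \<in> \<tau> ` {1..<i}" by auto
  qed
  then have "card (\<sigma> ` {1..i}) \<le> card (\<tau> ` {1..<i})" by (intro card_mono) auto
  moreover have "card (\<sigma> ` {1..i}) = i" "card (\<tau> ` {1..<i}) = i - 1"
    using card_image[OF permutes_inj_on[OF p]] card_image[OF permutes_inj_on[OF q]] by auto
  ultimately show False using assms(3) by auto
qed

lemma decreasing_arrangement_upper_set:
  assumes "decreasing_arrangement n X \<sigma>" "i \<in> {1..n}" "i \<noteq> n" "X (\<sigma> (i + 1)) < X (\<sigma> i)"
  shows "\<sigma> ` {1..i} = {y \<in> {1..n}. X y \<ge> X (\<sigma> i)}"
proof
  have p: "\<sigma> permutes {1..n}" using assms by (auto simp: decreasing_arrangement_def)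
  show "\<sigma> ` {1..i} \<subseteq> {y \<in> {1..n}. X y \<ge> X (\<sigma> i)}"
  proof
    fix y assume "y \<in> \<sigma> ` {1..i}"
    then obtain j where j: "j \<in> {1..i}" "y = \<sigma> j" by auto
    then have j': "j \<in> {1..n}" using assms(2) by auto
    then have "y \<in> {1..n}" using permutes_in_image[OF p, of j] j by metis
    moreover have "X y \<ge> X (\<sigma> i)"
      using assms(1,2) j j' by (auto simp: decreasing_arrangement_def)
    ultimately show "y \<in> {y \<in> {1..n}. X y \<ge> X (\<sigma> i)}" by blast
  qed
  show "{y \<in> {1..n}. X y \<ge> X (\<sigma> i)} \<subseteq> \<sigma> ` {1..i}"
  proof
    fix y assume y: "y \<in> {y \<in> {1..n}. X y \<ge> X (\<sigma> i)}"
    then obtain l where l: "l \<in> {1..n}" "y = \<sigma> l" using permutes_image[OF p] by blast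
    have "l \<le> i"
    proof (rule ccontr)
      assume "\<not> l \<le> i"
      then have "X (\<sigma> l) \<le> X (\<sigma> (i + 1))"
        using assms l by (auto simp: decreasing_arrangement_def)
      then show False using assms(4) y l by auto
    qed
    then show "y \<in> \<sigma> ` {1..i}" using l by auto
  qed
qed

lemma choquet_eq:
  assumes "decreasing_arrangement n X \<sigma>"
  shows "choquet n \<phi> X = choquet_sum n \<phi> X \<sigma>"
proof -
  define \<tau> where "\<tau> = (SOME \<sigma>. decreasing_arrangement n X \<sigma>)"
  have \<tau>: "decreasing_arrangement n X \<tau>"
    unfolding \<tau>_def using decreasing_arrangement_exists by (rule someI_ex)
  have val: "X (\<tau> i) = X (\<sigma> i)" if "i \<in> {1..n}" for i
    using decreasing_arrangement_values[OF assms \<tau> that]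
      decreasing_arrangement_values[OF \<tau> assms that] by linarith
  have "choquet_sum n \<phi> X \<tau> = choquet_sum n \<phi> X \<sigma>"
    unfolding choquet_sum_def
  proof (rule sum.cong[OF refl])
    fix i assume i: "i \<in> {1..n}"
    show "(X (\<tau> i) - (if i = n then 0 else X (\<tau> (i + 1)))) * \<phi> (\<tau> ` {1..i}) =
          (X (\<sigma> i) - (if i = n then 0 else X (\<sigma> (i + 1)))) * \<phi> (\<sigma> ` {1..i})"
    proof (cases "i = n")
      case True
      then show ?thesis
        using val[OF i] assms \<tau> permutes_image[of \<sigma> "{1..n}"] permutes_image[of \<tau> "{1..n}"]
        by (simp add: decreasing_arrangement_def)
    next
      case False
      then have v: "X (\<tau> (i + 1)) = X (\<sigma> (i + 1))" using val[of "i + 1"] i by auto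
      have le: "X (\<sigma> (i + 1)) \<le> X (\<sigma> i)"
        using assms i False by (auto simp: decreasing_arrangement_def)
      show ?thesis
      proof (cases "X (\<sigma> (i + 1)) = X (\<sigma> i)")
        case True
        then show ?thesis using False v val[OF i] by simp
      next
        case ne: False
        then have "X (\<sigma> (i + 1)) < X (\<sigma> i)" using le by simp
        then have "\<tau> ` {1..i} = \<sigma> ` {1..i}"
          using decreasing_arrangement_upper_set[OF assms i False]
            decreasing_arrangement_upper_set[OF \<tau> i False] v val[OF i] by simp
        then show ?thesis using v val[OF i] by simp
      qed
    qed
  qed
  then show ?thesis by (simp add: choquet_def \<tau>_def)
qed

definition discounted :: "real \<Rightarrow> ('a \<Rightarrow> real) \<Rightarrow> 'a \<Rightarrow> real" where
  "discounted r X = (\<lambda>i. inverse (1 + r) * X i)"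

definition gain ::
    "real \<Rightarrow> nat \<Rightarrow> (nat \<Rightarrow> 'a \<Rightarrow> real) \<Rightarrow> (('a \<Rightarrow> real) \<Rightarrow> real) \<Rightarrow> (nat \<Rightarrow> real) \<Rightarrow> 'a set \<Rightarrow> real"
  where
  "gain r m S \<pi> l B = (\<Sum>k=1..m. l k * ((MIN i\<in>B. discounted r (S k) i) - \<pi> (S k)))"

end

theory Submission
  imports Defs "HOL-Analysis.Analysis"
begin

text \<open>By Moebius inversion a set function is a belief function exactly when it is
  \<open>A \<mapsto> (\<Sum>B\<subseteq>A. \<mu> B)\<close> for a probability mass \<open>\<mu>\<close> on the nonempty events, and its Choquet
  expectation is then \<open>(\<Sum>B. \<mu> B * min\<^sub>B X)\<close>. So (i) asks for convex weights on the nonempty events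
  for which the vectors \<open>(min\<^sub>B S\<^sub>k - \<pi>\<^sub>k)\<^sub>k\<close> average to zero, and (ii) says that
  no linear functional is strictly positive or strictly negative on all these vectors; the two are
  equivalent by separating the origin from the convex hull.\<close>

section \<open>From masses on nonempty events to belief functions\<close>

definition belief_of_mass :: "('a set \<Rightarrow> real) \<Rightarrow> 'a set \<Rightarrow> real" where
  "belief_of_mass \<mu> A = (\<Sum>B\<in>Pow A - {{}}. \<mu> B)"

definition mass_function :: "'a set \<Rightarrow> ('a set \<Rightarrow> real) \<Rightarrow> bool" where
  "mass_function \<Omega> \<mu> \<longleftrightarrow> (\<forall>B\<in>Pow \<Omega> - {{}}. 0 \<le> \<mu> B) \<and> sum \<mu> (Pow \<Omega> - {{}}) = 1"

text \<open>An index set that does not depend on \<open>A\<close> makes it possible to exchange the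
  sum over focal events with sums over several \<open>A\<close>.\<close>

lemma belief_of_mass_eq_indicator_sum:
  assumes "finite \<Omega>" "A \<subseteq> \<Omega>"
  shows "belief_of_mass \<mu> A = (\<Sum>B\<in>Pow \<Omega> - {{}}. \<mu> B * of_bool (B \<subseteq> A))"
proof -
  have "(\<Sum>B\<in>Pow \<Omega> - {{}}. \<mu> B * of_bool (B \<subseteq> A)) = (\<Sum>B\<in>Pow \<Omega> - {{}}. if B \<subseteq> A then \<mu> B else 0)"
    by (intro sum.cong) auto
  also have "\<dots> = (\<Sum>B\<in>{B \<in> Pow \<Omega> - {{}}. B \<subseteq> A}. \<mu> B)"
    using assms by (subst sum.inter_filter) auto
  also have "{B \<in> Pow \<Omega> - {{}}. B \<subseteq> A} = Pow A - {{}}"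
    using assms by auto
  finally show ?thesis by (simp add: belief_of_mass_def)
qed

text \<open>This is inclusion-exclusion for the point mass at \<open>B\<close>, an additive function
  on families of sets. The families are the down-sets \<open>G i\<close> of the \<open>A i\<close>:
  the down-set of an intersection is the intersection of the down-sets, whereas their union only
  catches a \<open>B\<close> that lies inside a single \<open>A i\<close>.\<close>

lemma indicator_inclusion_exclusion:
  assumes "finite I"
  shows "(\<Sum>K\<in>Pow I - {{}}. (-1) ^ (card K - 1) * (of_bool (B \<subseteq> (\<Inter>i\<in>K. A i)) :: real))
       = of_bool (\<exists>i\<in>I. B \<subseteq> A i)"
proof -
  define f where "f S = (of_bool (B \<in> S) :: real)" for S
  define G where "G i = {C. C \<subseteq> A i}" for i
  have "f (\<Union>(G ` I)) = (\<Sum>K | K \<subseteq> I \<and> K \<noteq> {}. (-1) ^ (card K + 1) * f (\<Inter>(G ` K)))"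
    using assms by (intro Incl_Excl_UN) (auto simp: f_def disjnt_iff)
  also have "\<dots> = (\<Sum>K\<in>Pow I - {{}}. (-1) ^ (card K - 1) * of_bool (B \<subseteq> (\<Inter>i\<in>K. A i)))"
  proof (rule sum.cong)
    fix K assume K: "K \<in> Pow I - {{}}"
    \<comment> \<open>Since \<open>K\<close> is nonempty, the truncated exponent
      \<open>card K - 1\<close> has the parity of \<open>card K + 1\<close>.\<close>
    then have "card K \<noteq> 0" using assms finite_subset by fastforce
    then obtain c where "card K = Suc c" using not0_implies_Suc by blast
    moreover have "B \<in> \<Inter>(G ` K) \<longleftrightarrow> B \<subseteq> (\<Inter>i\<in>K. A i)" by (auto simp: G_def)
    ultimately show "(-1) ^ (card K + 1) * f (\<Inter>(G ` K))
      = (-1) ^ (card K - 1) * of_bool (B \<subseteq> (\<Inter>i\<in>K. A i))" by (simp add: f_def)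
  qed auto
  finally show ?thesis by (simp add: f_def G_def)
qed

text \<open>By linearity in \<open>\<mu>\<close> the coefficients of each \<open>\<mu> B\<close> can
  be compared. The alternating sum gives 1 if some \<open>A i\<close> contains \<open>B\<close>, the
  union gives 1 if it contains \<open>B\<close>; the latter is weaker, and nonnegative masses
  preserve the inequality.\<close>

lemma completely_monotone_belief_of_mass:
  assumes \<Omega>: "finite \<Omega>" and \<mu>: "\<And>B. B \<in> Pow \<Omega> - {{}} \<Longrightarrow> 0 \<le> \<mu> B"
  shows "completely_monotone \<Omega> (belief_of_mass \<mu>)"
  unfolding completely_monotone_def
proof (intro allI impI ballI)
  fix k :: nat and A assume "A \<in> {1..k} \<rightarrow> Pow \<Omega>"
  then have A: "A i \<subseteq> \<Omega>" if "i \<in> {1..k}" for i using that by auto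
  let ?U = "Pow \<Omega> - {{}}" and ?I = "Pow {1..k} - {{}}"
  have "(\<Sum>K\<in>?I. (-1) ^ (card K - 1) * belief_of_mass \<mu> (\<Inter>i\<in>K. A i))
      = (\<Sum>K\<in>?I. \<Sum>B\<in>?U. \<mu> B * ((-1) ^ (card K - 1) * of_bool (B \<subseteq> (\<Inter>i\<in>K. A i))))"
  proof (rule sum.cong[OF refl])
    fix K assume K: "K \<in> ?I"
    then have "(\<Inter>i\<in>K. A i) \<subseteq> \<Omega>" using A by blast
    from belief_of_mass_eq_indicator_sum[OF \<Omega> this]
    show "(-1) ^ (card K - 1) * belief_of_mass \<mu> (\<Inter>i\<in>K. A i)
      = (\<Sum>B\<in>?U. \<mu> B * ((-1) ^ (card K - 1) * of_bool (B \<subseteq> (\<Inter>i\<in>K. A i))))"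
      by (simp add: sum_distrib_left mult.left_commute)
  qed
  also have "\<dots> = (\<Sum>B\<in>?U. \<mu> B * (\<Sum>K\<in>?I. (-1) ^ (card K - 1) * of_bool (B \<subseteq> (\<Inter>i\<in>K. A i))))"
    by (subst sum.swap) (simp only: sum_distrib_left)
  also have "\<dots> = (\<Sum>B\<in>?U. \<mu> B * of_bool (\<exists>i\<in>{1..k}. B \<subseteq> A i))"
    by (subst indicator_inclusion_exclusion) auto
  also have "\<dots> \<le> (\<Sum>B\<in>?U. \<mu> B * of_bool (B \<subseteq> (\<Union>i\<in>{1..k}. A i)))"
  proof (intro sum_mono mult_left_mono \<mu>)
    show "of_bool (\<exists>i\<in>{1..k}. B \<subseteq> A i) \<le> (of_bool (B \<subseteq> (\<Union>i\<in>{1..k}. A i)) :: real)" for B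
      by (simp add: of_bool_def) blast
  qed
  also have "\<dots> = belief_of_mass \<mu> (\<Union>i\<in>{1..k}. A i)"
    using A by (intro belief_of_mass_eq_indicator_sum[OF \<Omega>, symmetric]) blast
  finally show "(\<Sum>K\<in>?I. (-1) ^ (card K - 1) * belief_of_mass \<mu> (\<Inter>i\<in>K. A i))
      \<le> belief_of_mass \<mu> (\<Union>i\<in>{1..k}. A i)" .
qed

lemma belief_function_of_mass:
  assumes \<Omega>: "finite \<Omega>" and \<mu>: "mass_function \<Omega> \<mu>"
  shows "belief_function \<Omega> (belief_of_mass \<mu>)"
proof -
  have nonneg: "\<And>B. B \<in> Pow \<Omega> - {{}} \<Longrightarrow> 0 \<le> \<mu> B" and one: "belief_of_mass \<mu> \<Omega> = 1"
    using \<mu> by (auto simp: mass_function_def belief_of_mass_def)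
  have mono: "belief_of_mass \<mu> A \<le> belief_of_mass \<mu> B" if "A \<subseteq> B" "B \<subseteq> \<Omega>" for A B
    unfolding belief_of_mass_def
    using that finite_subset[OF _ \<Omega>] by (intro sum_mono2 nonneg) auto
  have empty: "belief_of_mass \<mu> {} = 0" by (simp add: belief_of_mass_def)
  have "0 \<le> belief_of_mass \<mu> A \<and> belief_of_mass \<mu> A \<le> 1" if "A \<subseteq> \<Omega>" for A
    using mono[of "{}" A] mono[of A \<Omega>] that empty one by auto
  then show ?thesis
    using mono empty one completely_monotone_belief_of_mass[OF \<Omega> nonneg]
    by (auto simp: belief_function_def capacity_def)
qed

section \<open>Moebius inversion: from belief functions back to masses\<close>

text \<open>For \<open>T \<subseteq> A\<close> the exponent has the parity of the usual
  \<open>card A - card T\<close>; the sum avoids truncated subtraction.\<close>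

definition moebius_mass :: "('a set \<Rightarrow> real) \<Rightarrow> 'a set \<Rightarrow> real" where
  "moebius_mass \<phi> A = (\<Sum>T\<in>Pow A. (-1) ^ (card A + card T) * \<phi> T)"

lemma moebius_inversion:
  assumes "finite A"
  shows "\<phi> A = (\<Sum>T\<in>Pow A. moebius_mass \<phi> T)"
proof -
  \<comment> \<open>The signed subset sum is an involution on set functions; the inner sum times
    \<open>(-1) ^ card T\<close> is \<open>moebius_mass \<phi> T\<close>.\<close>
  have "\<phi> A = (\<Sum>T\<in>Pow A. (-1) ^ card T * (\<Sum>U\<in>Pow T. (-1) ^ card U * \<phi> U))"
    using assms by (rule inclusion_exclusion_symmetric[rotated]) simp
  then show ?thesis
    by (simp add: moebius_mass_def sum_distrib_left power_add mult.assoc)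
qed

text \<open>Complete monotonicity of \<open>\<phi>\<close> applied to the sets \<open>A - {a}\<close> with \<open>a \<in> A\<close>, whose union is
  \<open>A\<close> as soon as \<open>card A \<ge> 2\<close>.\<close>

lemma moebius_nonneg:
  assumes \<Omega>: "finite \<Omega>" and \<phi>: "belief_function \<Omega> \<phi>" and A: "A \<subseteq> \<Omega>" "A \<noteq> {}"
  shows "0 \<le> moebius_mass \<phi> A"
proof -
  have finA: "finite A" using A \<Omega> finite_subset by blast
  define k where "k = card A"
  obtain h where h: "bij_betw h {1..k} A"
    using ex_bij_betw_nat_finite_1[OF finA] k_def by auto
  have inj: "inj_on h {1..k}" and img: "h ` {1..k} = A" using h by (auto simp: bij_betw_def)
  have "bij_betw (\<lambda>K. A - h ` K) (Pow {1..k}) (Pow A)"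
  proof (rule bij_betw_byWitness[where f' = "\<lambda>T. {i\<in>{1..k}. h i \<notin> T}"])
    show "\<forall>K\<in>Pow {1..k}. {i\<in>{1..k}. h i \<notin> A - h ` K} = K"
    proof
      fix K assume K: "K \<in> Pow {1..k}"
      then have "h i \<in> h ` K \<longleftrightarrow> i \<in> K" if "i \<in> {1..k}" for i
        using inj_on_image_mem_iff[OF inj that, of K] by blast
      then show "{i\<in>{1..k}. h i \<notin> A - h ` K} = K" using K img by blast
    qed
    show "\<forall>T\<in>Pow A. A - h ` {i\<in>{1..k}. h i \<notin> T} = T" using img by blast
    show "(\<lambda>T. {i\<in>{1..k}. h i \<notin> T}) ` Pow A \<subseteq> Pow {1..k}" by blast
    show "(\<lambda>K. A - h ` K) ` Pow {1..k} \<subseteq> Pow A" by blast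
  qed
  then have "moebius_mass \<phi> A = (\<Sum>K\<in>Pow {1..k}. (-1) ^ (card A + card (A - h ` K)) * \<phi> (A - h ` K))"
    unfolding moebius_mass_def by (rule sum.reindex_bij_betw[symmetric])
  also have "\<dots> = (\<Sum>K\<in>Pow {1..k}. (-1) ^ card K * \<phi> (A - h ` K))"
  proof (rule sum.cong[OF refl])
    fix K assume K: "K \<in> Pow {1..k}"
    have "card (h ` K) = card K" using K inj by (auto intro!: card_image inj_on_subset[OF inj])
    moreover have "h ` K \<subseteq> A" using K img by auto
    then have "card A = card (A - h ` K) + card (h ` K)"
      using finA by (metis Diff_partition Diff_disjoint add.commute card_Un_disjoint finite_Diff finite_subset)
    ultimately have "card A + card (A - h ` K) = 2 * card (A - h ` K) + card K"
      by simp
    then show "(-1) ^ (card A + card (A - h ` K)) * \<phi> (A - h ` K) = (-1) ^ card K * \<phi> (A - h ` K)"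
      by (simp add: power_add)
  qed
  \<comment> \<open>The term for \<open>{}\<close> is split off because an intersection over no
    indices would be \<open>UNIV\<close> instead of \<open>A\<close>.\<close>
  also have "\<dots> = \<phi> A + (\<Sum>K\<in>Pow {1..k} - {{}}. (-1) ^ card K * \<phi> (A - h ` K))"
    by (subst sum.remove[of _ "{}"]) auto
  also have "(\<Sum>K\<in>Pow {1..k} - {{}}. (-1) ^ card K * \<phi> (A - h ` K))
      = - (\<Sum>K\<in>Pow {1..k} - {{}}. (-1) ^ (card K - 1) * \<phi> (\<Inter>i\<in>K. A - {h i}))"
    unfolding sum_negf[symmetric]
  proof (rule sum.cong[OF refl])
    fix K assume K: "K \<in> Pow {1..k} - {{}}"
    then have "card K \<noteq> 0" using finite_subset by fastforce
    then obtain c where "card K = Suc c" using not0_implies_Suc by blast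
    moreover have "(\<Inter>i\<in>K. A - {h i}) = A - h ` K" using K by auto
    ultimately show "(-1) ^ card K * \<phi> (A - h ` K)
        = - ((-1) ^ (card K - 1) * \<phi> (\<Inter>i\<in>K. A - {h i}))" by simp
  qed
  finally have eq: "moebius_mass \<phi> A
    = \<phi> A - (\<Sum>K\<in>Pow {1..k} - {{}}. (-1) ^ (card K - 1) * \<phi> (\<Inter>i\<in>K. A - {h i}))" by simp
  show ?thesis
  proof (cases "k \<ge> 2")
    case True
    have "(\<Union>i\<in>{1..k}. A - {h i}) = A"
    proof
      show "A \<subseteq> (\<Union>i\<in>{1..k}. A - {h i})"
      proof
        fix x assume "x \<in> A"
        moreover have I: "1 \<in> {1..k}" "2 \<in> {1..k}" using True by auto
        moreover have "h 1 \<noteq> h 2" using inj_onD[OF inj _ I] by auto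
        ultimately show "x \<in> (\<Union>i\<in>{1..k}. A - {h i})" by blast
      qed
    qed auto
    moreover have "(\<lambda>i. A - {h i}) \<in> {1..k} \<rightarrow> Pow \<Omega>" using A by auto
    then have "\<phi> (\<Union>i\<in>{1..k}. A - {h i})
      \<ge> (\<Sum>K\<in>Pow {1..k} - {{}}. (-1) ^ (card K - 1) * \<phi> (\<Inter>i\<in>K. A - {h i}))"
      using \<phi> True unfolding belief_function_def completely_monotone_def by blast
    ultimately show ?thesis using eq by simp
  next
    \<comment> \<open>Complete monotonicity starts at two sets, so for a singleton the mass
      \<open>\<phi> {a} - \<phi> {}\<close> is bounded by monotonicity of the capacity.\<close>
    case False
    then have "k = 1" using finA A card_gt_0_iff[of A] by (simp add: k_def)
    then obtain a where "A = {a}" using k_def card_1_singletonE by metis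
    moreover have "\<phi> {} \<le> \<phi> A" using \<phi> A by (auto simp: belief_function_def capacity_def)
    ultimately show ?thesis by (simp add: moebius_mass_def Pow_insert)
  qed
qed

lemma belief_function_moebius:
  assumes \<Omega>: "finite \<Omega>" and \<phi>: "belief_function \<Omega> \<phi>"
  shows "mass_function \<Omega> (moebius_mass \<phi>)" and "A \<subseteq> \<Omega> \<Longrightarrow> \<phi> A = belief_of_mass (moebius_mass \<phi>) A"
proof -
  have bel: "\<phi> A = belief_of_mass (moebius_mass \<phi>) A" if "A \<subseteq> \<Omega>" for A
  proof -
    have "finite A" using that \<Omega> finite_subset by blast
    \<comment> \<open>\<open>belief_of_mass\<close> leaves out the empty event; as its Moebius
      coefficient is \<open>\<phi> {} = 0\<close>, the inversion formula loses nothing.\<close>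
    moreover have "moebius_mass \<phi> {} = 0"
      using \<phi> by (simp add: moebius_mass_def belief_function_def capacity_def)
    ultimately show ?thesis
      unfolding belief_of_mass_def
      by (subst moebius_inversion) (auto simp: sum.remove[of _ "{}"])
  qed
  then show "A \<subseteq> \<Omega> \<Longrightarrow> \<phi> A = belief_of_mass (moebius_mass \<phi>) A" .
  have "sum (moebius_mass \<phi>) (Pow \<Omega> - {{}}) = 1"
    using bel[of \<Omega>] \<phi> by (simp add: belief_of_mass_def belief_function_def capacity_def)
  then show "mass_function \<Omega> (moebius_mass \<phi>)"
    using moebius_nonneg[OF \<Omega> \<phi>] by (auto simp: mass_function_def)
qed

section \<open>Choquet expectation as a weighted mean of minima\<close>

text \<open>Let \<open>j\<close> be the last position at which \<open>\<sigma>\<close> visits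
  \<open>B\<close>. The initial segments contain \<open>B\<close> exactly from \<open>j\<close> on,
  so the sum telescopes to \<open>X (\<sigma> j)\<close>, which is the least value on
  \<open>B\<close> because the arrangement is decreasing.\<close>

lemma choquet_sum_unanimity:
  assumes \<sigma>: "decreasing_arrangement n X \<sigma>" and B: "B \<subseteq> {1..n}" "B \<noteq> {}"
  shows "choquet_sum n (\<lambda>A. of_bool (B \<subseteq> A)) X \<sigma> = (MIN i\<in>B. X i)"
proof -
  have p: "\<sigma> permutes {1..n}" using \<sigma> by (simp add: decreasing_arrangement_def)
  define J where "J = {i\<in>{1..n}. \<sigma> i \<in> B}"
  have J: "finite J" "\<sigma> ` J = B"
  proof -
    show "\<sigma> ` J = B"
    proof
      show "B \<subseteq> \<sigma> ` J"
      proof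
        fix y assume "y \<in> B"
        moreover from this B permutes_image[OF p] obtain i where "i \<in> {1..n}" "y = \<sigma> i" by blast
        ultimately show "y \<in> \<sigma> ` J" by (auto simp: J_def)
      qed
    qed (auto simp: J_def)
  qed (simp add: J_def)
  then have "J \<noteq> {}" using B by auto
  define j where "j = Max J"
  have jJ: "j \<in> J" and jmax: "\<And>i. i \<in> J \<Longrightarrow> i \<le> j"
    using J \<open>J \<noteq> {}\<close> by (auto simp: j_def)
  then have j: "1 \<le> j" "j \<le> n" by (auto simp: J_def)
  have sub: "B \<subseteq> \<sigma> ` {1..i} \<longleftrightarrow> j \<le> i" for i
  proof
    assume "B \<subseteq> \<sigma> ` {1..i}"
    moreover have "\<sigma> j \<in> B" using jJ by (simp add: J_def)
    ultimately obtain l where "l \<in> {1..i}" "\<sigma> j = \<sigma> l" by blast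
    then show "j \<le> i" using permutes_inj[OF p] by (auto dest: injD)
  next
    assume "j \<le> i"
    then have "J \<subseteq> {1..i}" using jmax by (force simp: J_def)
    then show "B \<subseteq> \<sigma> ` {1..i}" using J by blast
  qed
  \<comment> \<open>Extending the values by 0 past \<open>n\<close> absorbs the boundary case, so
    the telescoped sum has no term left at its upper end.\<close>
  define Y where "Y i = (if n < i then 0 else X (\<sigma> i))" for i
  have "choquet_sum n (\<lambda>A. of_bool (B \<subseteq> A)) X \<sigma> = (\<Sum>i=1..n. if j \<le> i then Y i - Y (Suc i) else 0)"
    unfolding choquet_sum_def sub by (intro sum.cong) (auto simp: Y_def)
  also have "\<dots> = (\<Sum>i\<in>{i\<in>{1..n}. j \<le> i}. Y i - Y (Suc i))"
    by (rule sum.inter_filter[symmetric]) simp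
  also have "{i\<in>{1..n}. j \<le> i} = {j..n}" using j by auto
  also have "(\<Sum>i=j..n. Y i - Y (Suc i)) = Y j - Y (Suc n)"
    using sum_Suc_diff[of j n "\<lambda>i. - Y i"] j by simp
  also have "\<dots> = X (\<sigma> j)" using j by (simp add: Y_def)
  also have "\<dots> = (MIN i\<in>B. X i)"
  proof (rule Min_eqI[symmetric])
    show "finite (X ` B)" using B finite_subset by blast
    show "X (\<sigma> j) \<in> X ` B" using jJ by (auto simp: J_def)
    fix y assume "y \<in> X ` B"
    then obtain i where "i \<in> J" "y = X (\<sigma> i)" using J by blast
    then show "X (\<sigma> j) \<le> y"
      using \<sigma> jmax jJ by (auto simp: decreasing_arrangement_def J_def)
  qed
  finally show ?thesis .
qed

text \<open>For a fixed arrangement \<open>choquet_sum\<close> is linear in the set function, so it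
  respects the decomposition into unanimity games. Agreement on events suffices, which covers a
  given belief function with its Moebius mass as well as \<open>belief_of_mass\<close>
  itself.\<close>

lemma choquet_belief_of_mass:
  assumes \<phi>: "\<And>A. A \<subseteq> {1..n} \<Longrightarrow> \<phi> A = belief_of_mass \<mu> A"
  shows "choquet n \<phi> X = (\<Sum>B\<in>Pow {1..n} - {{}}. \<mu> B * (MIN i\<in>B. X i))"
proof -
  let ?U = "Pow {1..n} - {{}}"
  obtain \<sigma> where \<sigma>: "decreasing_arrangement n X \<sigma>" using decreasing_arrangement_exists by blast
  then have p: "\<sigma> permutes {1..n}" by (simp add: decreasing_arrangement_def)
  define D where "D i = X (\<sigma> i) - (if i = n then 0 else X (\<sigma> (i + 1)))" for i
  have "choquet n \<phi> X = (\<Sum>i=1..n. D i * \<phi> (\<sigma> ` {1..i}))"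
    by (simp add: choquet_eq[OF \<sigma>] choquet_sum_def D_def)
  also have "\<dots> = (\<Sum>i=1..n. \<Sum>B\<in>?U. \<mu> B * (D i * of_bool (B \<subseteq> \<sigma> ` {1..i})))"
  proof (rule sum.cong[OF refl])
    fix i assume "i \<in> {1..n}"
    then have "\<sigma> ` {1..i} \<subseteq> \<sigma> ` {1..n}" by auto
    then have "\<sigma> ` {1..i} \<subseteq> {1..n}" using permutes_image[OF p] by simp
    then have "\<phi> (\<sigma> ` {1..i}) = (\<Sum>B\<in>?U. \<mu> B * of_bool (B \<subseteq> \<sigma> ` {1..i}))"
      using \<phi> by (simp add: belief_of_mass_eq_indicator_sum[of "{1..n}"])
    then show "D i * \<phi> (\<sigma> ` {1..i}) = (\<Sum>B\<in>?U. \<mu> B * (D i * of_bool (B \<subseteq> \<sigma> ` {1..i})))"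
      by (simp only: sum_distrib_left mult.left_commute)
  qed
  also have "\<dots> = (\<Sum>B\<in>?U. \<mu> B * choquet_sum n (\<lambda>A. of_bool (B \<subseteq> A)) X \<sigma>)"
    unfolding choquet_sum_def D_def by (subst sum.swap) (simp only: sum_distrib_left)
  also have "\<dots> = (\<Sum>B\<in>?U. \<mu> B * (MIN i\<in>B. X i))"
    by (rule sum.cong[OF refl]) (simp add: choquet_sum_unanimity[OF \<sigma>])
  finally show ?thesis .
qed

section \<open>Convex weights and separation from the origin\<close>

text \<open>Weights are functions on the whole type, with coordinates outside \<open>U\<close>
  merely confined to the unit interval. The set is then a closed part of a cube that is compact by
  Tychonoff's theorem.\<close>

lemma compact_simplex:
  fixes U :: "'b set"
  assumes "finite U"
  shows "compact {w :: 'b \<Rightarrow> real. (\<forall>B. w B \<in> {0..1}) \<and> sum w U = 1}"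
proof -
  have "compactin (product_topology (\<lambda>_. euclidean) UNIV) (\<Pi>\<^sub>E B\<in>(UNIV :: 'b set). {0..1::real})"
    by (simp add: compactin_PiE)
  then have "compact (\<Pi>\<^sub>E B\<in>(UNIV :: 'b set). {0..1::real})"
    by (simp add: euclidean_product_topology)
  moreover have "closed {w :: 'b \<Rightarrow> real. sum w U = 1}"
    by (intro closed_Collect_eq continuous_on_sum continuous_on_product_coordinates continuous_on_const)
  ultimately have "compact ((\<Pi>\<^sub>E B\<in>(UNIV :: 'b set). {0..1::real}) \<inter> {w. sum w U = 1})"
    by (rule compact_Int_closed)
  moreover have "(\<Pi>\<^sub>E B\<in>(UNIV :: 'b set). {0..1::real}) \<inter> {w. sum w U = 1}
      = {w. (\<forall>B. w B \<in> {0..1}) \<and> sum w U = 1}"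
    by (auto simp: PiE_def Pi_def)
  ultimately show ?thesis by simp
qed

text \<open>Gordan's alternative: the origin is separated from the convex hull of the vectors
  \<open>(v k B)\<^sub>k\<close> by the point of the hull that is closest to it.\<close>

lemma convex_weights_zero_exists:
  fixes v :: "'k \<Rightarrow> 'b \<Rightarrow> real"
  assumes U: "finite U" and K: "finite K"
    and sep: "\<And>l. \<exists>B\<in>U. 0 \<le> (\<Sum>k\<in>K. l k * v k B)"
  shows "\<exists>w. (\<forall>B\<in>U. 0 \<le> w B) \<and> sum w U = 1 \<and> (\<forall>k\<in>K. (\<Sum>B\<in>U. w B * v k B) = 0)"
proof -
  define W where "W = {w :: 'b \<Rightarrow> real. (\<forall>B. w B \<in> {0..1}) \<and> sum w U = 1}"
  define c where "c w k = (\<Sum>B\<in>U. w B * v k B)" for w k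
  define Q where "Q w = (\<Sum>k\<in>K. (c w k)\<^sup>2)" for w
  have "compact W" unfolding W_def by (rule compact_simplex[OF U])
  moreover obtain B0 where B0: "B0 \<in> U" using sep by blast
  then have "(\<lambda>B. of_bool (B = B0)) \<in> W" using U by (simp add: W_def of_bool_def)
  then have "W \<noteq> {}" by blast
  moreover have "continuous_on W Q"
    unfolding Q_def c_def
    by (intro continuous_intros continuous_on_subset[OF continuous_on_product_coordinates]) auto
  ultimately obtain w where w: "w \<in> W" and min: "\<And>u. u \<in> W \<Longrightarrow> Q w \<le> Q u"
    using continuous_attains_inf by metis
  \<comment> \<open>Testing against minus the closest point \<open>c w\<close> gives a vertex on the
    far side of the origin or orthogonal to \<open>c w\<close>; moving towards it would shorten a
    nonzero \<open>c w\<close>.\<close>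
  obtain B where B: "B \<in> U" and neg: "(\<Sum>k\<in>K. c w k * v k B) \<le> 0"
    using sep[of "\<lambda>k. - c w k"] by (auto simp: sum_negf)
  define D where "D = (\<Sum>k\<in>K. (v k B - c w k)\<^sup>2)"
  have D: "0 \<le> D" by (simp add: D_def sum_nonneg)
  have Q0: "0 \<le> Q w" by (simp add: Q_def sum_nonneg)
  \<comment> \<open>Shift the fraction \<open>t\<close> of the weight to \<open>B\<close>, expand
    the squared norm, use minimality of \<open>Q w\<close> and divide by \<open>t\<close>.\<close>
  have move: "2 * Q w \<le> t * D" if t: "0 < t" "t \<le> 1" for t
  proof -
    define u where "u C = (1 - t) * w C + t * of_bool (C = B)" for C
    have "u \<in> W"
    proof -
      have "u C \<in> {0..1}" for C
      proof -
        have wC: "0 \<le> w C" "w C \<le> 1" using w by (auto simp: W_def)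
        have "(1 - t) * w C \<le> 1 - t" using wC t by (simp add: mult_left_le)
        moreover have "0 \<le> (1 - t) * w C" using wC t by simp
        ultimately show ?thesis using t by (auto simp: u_def)
      qed
      moreover have "sum u U = (1 - t) * sum w U + t * (\<Sum>C\<in>U. of_bool (C = B))"
        unfolding sum_distrib_left sum.distrib[symmetric] by (rule sum.cong) (simp_all add: u_def)
      then have "sum u U = 1" using w U B by (simp add: W_def of_bool_def)
      ultimately show ?thesis by (simp add: W_def)
    qed
    have "c u k = c w k + t * (v k B - c w k)" for k
    proof -
      have "c u k = (\<Sum>C\<in>U. (1 - t) * (w C * v k C) + t * (if C = B then v k C else 0))"
        unfolding c_def by (intro sum.cong) (auto simp: u_def algebra_simps)
      also have "\<dots> = (1 - t) * c w k + t * (\<Sum>C\<in>U. if C = B then v k C else 0)"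
        by (simp only: sum.distrib sum_distrib_left c_def)
      also have "\<dots> = c w k + t * (v k B - c w k)"
        using U B by (simp add: algebra_simps)
      finally show ?thesis .
    qed
    then have "Q u = (\<Sum>k\<in>K. (c w k + t * (v k B - c w k))\<^sup>2)" by (simp add: Q_def)
    also have "\<dots> = (\<Sum>k\<in>K. (c w k)\<^sup>2 + 2 * t * (c w k * v k B) - 2 * t * (c w k)\<^sup>2
        + t\<^sup>2 * (v k B - c w k)\<^sup>2)"
      by (intro sum.cong) (simp_all add: power2_eq_square algebra_simps)
    also have "\<dots> = Q w + 2 * t * (\<Sum>k\<in>K. c w k * v k B) - 2 * t * Q w + t\<^sup>2 * D"
      by (simp only: sum.distrib sum_subtractf sum_distrib_left Q_def D_def)
    also have "\<dots> \<le> Q w - 2 * t * Q w + t\<^sup>2 * D"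
      using neg t by (simp add: mult_nonneg_nonpos)
    finally have "t * (2 * Q w) \<le> t * (t * D)"
      using min[OF \<open>u \<in> W\<close>] by (simp add: power2_eq_square algebra_simps)
    then show ?thesis using t by simp
  qed
  have "Q w = 0"
  proof (rule ccontr)
    assume "Q w \<noteq> 0"
    then have pos: "0 < Q w" using Q0 by simp
    \<comment> \<open>This \<open>t\<close> lies in the admissible range even if
      \<open>D = 0\<close>, and is small enough that \<open>t * D \<le> Q w\<close>.\<close>
    have "2 * Q w \<le> Q w / (Q w + D) * D" using pos D by (intro move) (auto simp: field_simps)
    also have "\<dots> \<le> Q w" using pos D by (simp add: field_simps)
    finally show False using pos by simp
  qed
  then have "\<forall>k\<in>K. c w k = 0" using K by (simp add: Q_def sum_nonneg_eq_0_iff)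
  then show ?thesis using w by (intro exI[of _ w]) (auto simp: W_def c_def)
qed

text \<open>A weighted mean lies between the extreme values; here the mean is zero.\<close>

lemma convex_combination_zero_bounds:
  fixes g w :: "'b \<Rightarrow> real"
  assumes U: "finite U" and w: "\<And>B. B \<in> U \<Longrightarrow> 0 \<le> w B" "sum w U = 1"
    and zero: "(\<Sum>B\<in>U. w B * g B) = 0"
  shows "(MIN B\<in>U. g B) \<le> 0" and "0 \<le> (MAX B\<in>U. g B)"
proof -
  have "(MIN B\<in>U. g B) = (\<Sum>B\<in>U. w B * (MIN B\<in>U. g B))"
    using w by (simp flip: sum_distrib_right)
  also have "\<dots> \<le> (\<Sum>B\<in>U. w B * g B)"
    using U w by (intro sum_mono mult_left_mono) auto
  finally show "(MIN B\<in>U. g B) \<le> 0" using zero by simp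
  have "(\<Sum>B\<in>U. w B * g B) \<le> (\<Sum>B\<in>U. w B * (MAX B\<in>U. g B))"
    using U w by (intro sum_mono mult_left_mono) auto
  also have "\<dots> = (MAX B\<in>U. g B)"
    using w by (simp flip: sum_distrib_right)
  finally show "0 \<le> (MAX B\<in>U. g B)" using zero by simp
qed

theorem theorem4:
  fixes n m :: nat and r :: real
    and S :: "nat \<Rightarrow> nat \<Rightarrow> real" and \<pi> :: "(nat \<Rightarrow> real) \<Rightarrow> real"
  assumes "n \<ge> 1" and "1 + r > 0" and "m \<ge> 1"
    and "S \<in> {1..m} \<rightarrow> ({1..n} \<rightarrow>\<^sub>E UNIV)"
  shows "(\<exists>Bel. belief_function {1..n} Bel \<and>
            (\<forall>k\<in>{1..m}. choquet n Bel (discounted r (S k)) = \<pi> (S k)))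
         \<longleftrightarrow>
         (\<forall>l :: nat \<Rightarrow> real.
            (MIN B\<in>Pow {1..n} - {{}}. gain r m S \<pi> l B) \<le> 0 \<and>
            0 \<le> (MAX B\<in>Pow {1..n} - {{}}. gain r m S \<pi> l B))"
    (is "?consistent \<longleftrightarrow> ?bounds")
proof -
  let ?U = "Pow {1..n} - {{}}"
  define v where "v k B = (MIN i\<in>B. discounted r (S k) i) - \<pi> (S k)" for k B
  have gain: "gain r m S \<pi> l B = (\<Sum>k=1..m. l k * v k B)" for l B
    by (simp add: gain_def v_def)
  \<comment> \<open>Total mass one turns the averaged constant into the price, so the mean of
    \<open>v k\<close> is the pricing error. Both directions rest on this identity.\<close>
  have average: "(\<Sum>B\<in>?U. \<mu> B * v k B) = choquet n \<phi> (discounted r (S k)) - \<pi> (S k)"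
    if "mass_function {1..n} \<mu>" "\<And>A. A \<subseteq> {1..n} \<Longrightarrow> \<phi> A = belief_of_mass \<mu> A" for \<phi> \<mu> k
  proof -
    have "(\<Sum>B\<in>?U. \<mu> B * v k B)
        = (\<Sum>B\<in>?U. \<mu> B * (MIN i\<in>B. discounted r (S k) i)) - sum \<mu> ?U * \<pi> (S k)"
      by (simp only: v_def right_diff_distrib sum_subtractf sum_distrib_right)
    then show ?thesis
      using that(1) choquet_belief_of_mass[of n \<phi> \<mu>, OF that(2)] by (simp add: mass_function_def)
  qed
  show ?thesis
  proof
    assume ?consistent
    then obtain Bel where Bel: "belief_function {1..n} Bel"
      and price: "\<And>k. k \<in> {1..m} \<Longrightarrow> choquet n Bel (discounted r (S k)) = \<pi> (S k)" by blast
    define \<mu> where "\<mu> = moebius_mass Bel"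
    have \<mu>: "mass_function {1..n} \<mu>" "\<And>A. A \<subseteq> {1..n} \<Longrightarrow> Bel A = belief_of_mass \<mu> A"
      using belief_function_moebius[OF _ Bel] by (auto simp: \<mu>_def)
    show ?bounds
    proof
      fix l
      \<comment> \<open>Exchanging the sums makes the mean gain a linear combination of pricing
        errors, all of which vanish.\<close>
      have "(\<Sum>B\<in>?U. \<mu> B * gain r m S \<pi> l B) = (\<Sum>k=1..m. l k * (\<Sum>B\<in>?U. \<mu> B * v k B))"
        unfolding gain sum_distrib_left
        by (subst sum.swap) (simp only: mult.left_commute)
      also have "\<dots> = 0" using average[OF \<mu>] price by simp
      finally have "(\<Sum>B\<in>?U. \<mu> B * gain r m S \<pi> l B) = 0" .
      then show "(MIN B\<in>?U. gain r m S \<pi> l B) \<le> 0 \<and> 0 \<le> (MAX B\<in>?U. gain r m S \<pi> l B)"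
        using \<mu>(1) convex_combination_zero_bounds[of ?U \<mu> "gain r m S \<pi> l"]
        by (auto simp: mass_function_def)
    qed
  next
    assume bounds: ?bounds
    \<comment> \<open>Nonemptiness ensures that the maximum is attained, so its bound yields an
      actual event with nonnegative gain.\<close>
    have "?U \<noteq> {}" using \<open>n \<ge> 1\<close> by force
    then have "\<exists>B\<in>?U. 0 \<le> (\<Sum>k=1..m. l k * v k B)" for l
    proof -
      have "0 \<le> (MAX B\<in>?U. gain r m S \<pi> l B)" using bounds by blast
      moreover have "(MAX B\<in>?U. gain r m S \<pi> l B) \<in> gain r m S \<pi> l ` ?U"
        using \<open>?U \<noteq> {}\<close> by (intro Max_in) auto
      ultimately show ?thesis unfolding image_iff gain by auto
    qed
    then obtain w where "\<forall>B\<in>?U. 0 \<le> w B" "sum w ?U = 1"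
      and zero: "\<forall>k\<in>{1..m}. (\<Sum>B\<in>?U. w B * v k B) = 0"
      using convex_weights_zero_exists[of ?U "{1..m}" v] by auto
    then have w: "mass_function {1..n} w" by (simp add: mass_function_def)
    then have "belief_function {1..n} (belief_of_mass w)"
      by (intro belief_function_of_mass) simp
    moreover have "choquet n (belief_of_mass w) (discounted r (S k)) = \<pi> (S k)" if "k \<in> {1..m}" for k
      using average[OF w, of "belief_of_mass w" k] zero that by simp
    ultimately show ?consistent by blast
  qed
qed

end
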